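(* None of the pure type systems $\lambda^\tau$, $\lambda2$, $\lambda\omega$, $\lambda\underline{\omega}$, $\lambda\mathrm{P2}$, $\lambda\mathrm{P}\underline{\omega}$, $\lambda\mathrm C$, $\lambda\mathrm{AUT\text{-}68}$, $\lambda\mathrm{AUT\text{-}QE}$, $\lambda\mathrm{PAL}$, $\lambda\mathrm U$ and $\lambda\mathrm{HOL}$ has an equivalent Hilbert-style pure type system.
   Context: Pure type systems (PTS): a PTS has variables, constants $\mathcal C$, sorts $\mathcal S\subseteq\mathcal C$, axioms $\mathcal A$ ($c:s$), rules $\mathcal R\subseteq\mathcal S^3$; pseudoterms $\mathcal T::=V\mid\mathcal C\mid\Pi V{:}\mathcal T.\mathcal T\mid\lambda V{:}\mathcal T.\mathcal T\mid\mathcal T\mathcal T$; derivable judgements $\Gamma\vdash M:A$ are generated by (axiom) $\vdash c:s$ for $(c:s)\in\mathcal A$; (start) $\Gamma\vdash A:s\Rightarrow\Gamma,x:A\vdash x:A$ ($x$ fresh); (weakening) $\Gamma\vdash M:B$, $\Gamma\vdash A:s\Rightarrow\Gamma,x:A\vdash M:B$ ($x$ fresh); (application) $\Gamma\vdash M:\Pi x{:}A.B$, $\Gamma\vdash N:A\Rightarrow\Gamma\vdash MN:B[x:=N]$; (abstraction) $\Gamma,x:A\vdash M:B$, $\Gamma\vdash(\Pi x{:}A.B):s\Rightarrow\Gamma\vdash(\lambda x{:}A.M):(\Pi x{:}A.B)$; (product) $\Gamma,x:A\vdash B:s_2$, $\Gamma\vdash A:s_1$, $(s_1,s_2,s_3)\in\mathcal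 R\Rightarrow\Gamma\vdash(\Pi x{:}A.B):s_3$; (conversion) $\Gamma\vdash M:A$, $\Gamma\vdash B:s$, $A=_\beta B\Rightarrow\Gamma\vdash M:B$. Hilbert-style PTS (HPTS): same pseudoterms, only empty contexts, axioms $\mathcal A$ plus a finite set $\mathcal B$ of axiom schemes (sort variables instantiable by sorts); rules: the axioms, (application), (conversion) with empty contexts, (type reduction) $\vdash M:A$, $A\to_\beta B\Rightarrow\vdash M:B$, (subject reduction) $\vdash M:A$, $M\to_\beta N\Rightarrow\vdash N:A$. An HPTS $(\mathcal S,\mathcal A,\mathcal B)$ is equivalent to the PTS $(\mathcal S,\mathcal A,\mathcal R)$ if both derive exactly the same empty-context judgements $\vdash M:A$. The systems (writing $(s_1,s_2)$ for $(s_1,s_2,s_2)$; except for $\lambda^\tau$, $\mathcal C=\mathcal S$ is the set of constants occurring in $\mathcal A$ and $\mathcal R$): $\lambda^\tau$: $\mathcal S=\{*\}$, $\mathcal C=\{*,0\}$, $\mathcal A=\{0:*\}$, $\mathcal R=\{( *,* )\}$. All the following have $\mathcal A=\{*:\square\}$ unless stated: $\lambda2$: $\mathcal R=\{( *,* ),(\square,* )\}$; $\lambda\underline\omega$: $\{( *,* ),(\square,\square)\}$; $\lambda\omega$: $\{( *,* ),(\square,* ),(\square,\square)\}$; $\lambda\mathrm{P2}$: $\{( *,* ),(\square,* ),( *,\square)\}$; $\lambda\mathrm P\underline\omega$: $\{( *,* ),( *,\square),(\square,\square)\}$; $\lambda\mathrm C$: $\{( *,* ),( *,\square),(\square,* ),(\square,\square)\}$;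 $\lambda\mathrm{AUT\text{-}68}$: $\{( *,* ),( *,\square,\triangle),(\square,*,\triangle),(\square,\square,\triangle),( *,\triangle),(\square,\triangle)\}$; $\lambda\mathrm{AUT\text{-}QE}$: $\{( *,* ),( *,\square),(\square,*,\triangle),(\square,\square,\triangle),( *,\triangle),(\square,\triangle)\}$; $\lambda\mathrm{PAL}$: $\{( *,*,\triangle),( *,\square,\triangle),(\square,*,\triangle),(\square,\square,\triangle),( *,\triangle),(\square,\triangle)\}$; $\lambda\mathrm U$: $\mathcal A=\{*:\square,\square:\triangle\}$, $\mathcal R=\{( *,* ),(\square,* ),(\square,\square),(\triangle,\square),(\triangle,* )\}$; $\lambda\mathrm{HOL}$: $\mathcal A=\{*:\square,\square:\triangle\}$, $\mathcal R=\{( *,* ),(\square,* ),(\square,\square)\}$. *)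

theory Defs
  imports Main
begin

text \<open>
  Pseudoterms over the constants \<^typ>\<open>'c\<close> are taken up to renaming of bound variables, using
  de Bruijn indices: \<open>Pi A B\<close> and \<open>Lam A M\<close> bind index 0 in their second argument only.
\<close>

datatype 'c pterm =
    Var nat
  | Const 'c
  | Pi "'c pterm" "'c pterm"
  | Lam "'c pterm" "'c pterm"
  | App "'c pterm" "'c pterm"

primrec lift :: "nat \<Rightarrow> 'c pterm \<Rightarrow> 'c pterm" where
  "lift k (Var i) = (if i < k then Var i else Var (Suc i))"
| "lift k (Const c) = Const c"
| "lift k (Pi A B) = Pi (lift k A) (lift (Suc k) B)"
| "lift k (Lam A M) = Lam (lift k A) (lift (Suc k) M)"
| "lift k (App M N) = App (lift k M) (lift k N)"

text \<open>
  \<open>subst M N k\<close> replaces index \<open>k\<close> in \<open>M\<close> by \<open>N\<close> and removes that index, so that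
  \<open>subst M N 0\<close> is \<open>M[x := N]\<close> for the outermost variable \<open>x\<close> of \<open>M\<close>.
\<close>

primrec subst :: "'c pterm \<Rightarrow> 'c pterm \<Rightarrow> nat \<Rightarrow> 'c pterm" where
  "subst (Var i) N k = (if i < k then Var i else if i = k then N else Var (i - 1))"
| "subst (Const c) N k = Const c"
| "subst (Pi A B) N k = Pi (subst A N k) (subst B (lift 0 N) (Suc k))"
| "subst (Lam A M) N k = Lam (subst A N k) (subst M (lift 0 N) (Suc k))"
| "subst (App M P) N k = App (subst M N k) (subst P N k)"

inductive beta :: "'c pterm \<Rightarrow> 'c pterm \<Rightarrow> bool" (infix "\<rightarrow>\<^sub>\<beta>" 50) where
  beta_redex: "App (Lam A M) N \<rightarrow>\<^sub>\<beta> subst M N 0"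
| beta_Pi1: "A \<rightarrow>\<^sub>\<beta> A' \<Longrightarrow> Pi A B \<rightarrow>\<^sub>\<beta> Pi A' B"
| beta_Pi2: "B \<rightarrow>\<^sub>\<beta> B' \<Longrightarrow> Pi A B \<rightarrow>\<^sub>\<beta> Pi A B'"
| beta_Lam1: "A \<rightarrow>\<^sub>\<beta> A' \<Longrightarrow> Lam A M \<rightarrow>\<^sub>\<beta> Lam A' M"
| beta_Lam2: "M \<rightarrow>\<^sub>\<beta> M' \<Longrightarrow> Lam A M \<rightarrow>\<^sub>\<beta> Lam A M'"
| beta_App1: "M \<rightarrow>\<^sub>\<beta> M' \<Longrightarrow> App M N \<rightarrow>\<^sub>\<beta> App M' N"
| beta_App2: "N \<rightarrow>\<^sub>\<beta> N' \<Longrightarrow> App M N \<rightarrow>\<^sub>\<beta> App M N'"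

abbreviation beta_eq :: "'c pterm \<Rightarrow> 'c pterm \<Rightarrow> bool" (infix "=\<^sub>\<beta>" 50) where
  "A =\<^sub>\<beta> B \<equiv> equivclp beta A B"

text \<open>
  The set of constants of a system is the whole type \<^typ>\<open>'c\<close>.
\<close>

record 'c pts =
  sorts :: "'c set"
  axioms :: "('c \<times> 'c) set"
  rules :: "('c \<times> 'c \<times> 'c) set"

definition wf_pts :: "'c pts \<Rightarrow> bool" where
  "wf_pts P \<longleftrightarrow> axioms P \<subseteq> UNIV \<times> sorts P \<and> rules P \<subseteq> sorts P \<times> sorts P \<times> sorts P"

text \<open>
  The head of a context is its most recent declaration; lifting makes the freshness conditions
  of (start) and (weakening) automatic.
\<close>

inductive typing :: "'c pts \<Rightarrow> 'c pterm list \<Rightarrow> 'c pterm \<Rightarrow> 'c pterm \<Rightarrow> bool"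
  for P :: "'c pts" where
  ax: "(c, s) \<in> axioms P \<Longrightarrow> typing P [] (Const c) (Const s)"
| start: "typing P \<Gamma> A (Const s) \<Longrightarrow> s \<in> sorts P \<Longrightarrow> typing P (A # \<Gamma>) (Var 0) (lift 0 A)"
| weakening: "typing P \<Gamma> M B \<Longrightarrow> typing P \<Gamma> A (Const s) \<Longrightarrow> s \<in> sorts P \<Longrightarrow>
    typing P (A # \<Gamma>) (lift 0 M) (lift 0 B)"
| application: "typing P \<Gamma> M (Pi A B) \<Longrightarrow> typing P \<Gamma> N A \<Longrightarrow>
    typing P \<Gamma> (App M N) (subst B N 0)"
| abstraction: "typing P (A # \<Gamma>) M B \<Longrightarrow> typing P \<Gamma> (Pi A B) (Const s) \<Longrightarrow> s \<in> sorts P \<Longrightarrow>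
    typing P \<Gamma> (Lam A M) (Pi A B)"
| product: "typing P (A # \<Gamma>) B (Const s2) \<Longrightarrow> typing P \<Gamma> A (Const s1) \<Longrightarrow>
    (s1, s2, s3) \<in> rules P \<Longrightarrow> typing P \<Gamma> (Pi A B) (Const s3)"
| conversion: "typing P \<Gamma> M A \<Longrightarrow> typing P \<Gamma> B (Const s) \<Longrightarrow> s \<in> sorts P \<Longrightarrow> A =\<^sub>\<beta> B \<Longrightarrow>
    typing P \<Gamma> M B"

text \<open>
  An axiom scheme is a statement \<open>M : A\<close> whose terms may contain sort variables, here
  additional constants \<open>SortVar i\<close>; its instances replace the sort variables uniformly by sorts.
\<close>

datatype 'c sconst = Fixed 'c | SortVar nat

primrec inst_const :: "(nat \<Rightarrow> 'c) \<Rightarrow> 'c sconst \<Rightarrow> 'c" where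
  "inst_const \<sigma> (Fixed c) = c"
| "inst_const \<sigma> (SortVar i) = \<sigma> i"

abbreviation inst :: "(nat \<Rightarrow> 'c) \<Rightarrow> 'c sconst pterm \<Rightarrow> 'c pterm" where
  "inst \<sigma> \<equiv> map_pterm (inst_const \<sigma>)"

record 'c hpts =
  hsorts :: "'c set"
  haxioms :: "('c \<times> 'c) set"
  schemes :: "('c sconst pterm \<times> 'c sconst pterm) set"

definition wf_hpts :: "'c hpts \<Rightarrow> bool" where
  "wf_hpts H \<longleftrightarrow> haxioms H \<subseteq> UNIV \<times> hsorts H \<and> finite (schemes H)"

inductive htyping :: "'c hpts \<Rightarrow> 'c pterm \<Rightarrow> 'c pterm \<Rightarrow> bool"
  for H :: "'c hpts" where
  h_ax: "(c, s) \<in> haxioms H \<Longrightarrow> htyping H (Const c) (Const s)"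
| h_scheme: "(M, A) \<in> schemes H \<Longrightarrow> range \<sigma> \<subseteq> hsorts H \<Longrightarrow> htyping H (inst \<sigma> M) (inst \<sigma> A)"
| h_application: "htyping H M (Pi A B) \<Longrightarrow> htyping H N A \<Longrightarrow> htyping H (App M N) (subst B N 0)"
| h_conversion: "htyping H M A \<Longrightarrow> htyping H B (Const s) \<Longrightarrow> s \<in> hsorts H \<Longrightarrow> A =\<^sub>\<beta> B \<Longrightarrow>
    htyping H M B"
| h_type_reduction: "htyping H M A \<Longrightarrow> A \<rightarrow>\<^sub>\<beta> B \<Longrightarrow> htyping H M B"
| h_subject_reduction: "htyping H M A \<Longrightarrow> M \<rightarrow>\<^sub>\<beta> N \<Longrightarrow> htyping H N A"

definition equivalent :: "'c hpts \<Rightarrow> 'c pts \<Rightarrow> bool" where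
  "equivalent H P \<longleftrightarrow> hsorts H = sorts P \<and> haxioms H = axioms P \<and>
     (\<forall>M A. htyping H M A \<longleftrightarrow> typing P [] M A)"

definition has_equivalent_hpts :: "'c pts \<Rightarrow> bool" where
  "has_equivalent_hpts P \<longleftrightarrow> (\<exists>H. wf_hpts H \<and> equivalent H P)"

datatype tau_const = StarT | ZeroT

definition lambda_tau :: "tau_const pts" where
  "lambda_tau = \<lparr>sorts = {StarT}, axioms = {(ZeroT, StarT)}, rules = {(StarT, StarT, StarT)}\<rparr>"

datatype cube_const = StarC | BoxC

definition cube :: "(cube_const \<times> cube_const \<times> cube_const) set \<Rightarrow> cube_const pts" where
  "cube R = \<lparr>sorts = {StarC, BoxC}, axioms = {(StarC, BoxC)}, rules = R\<rparr>"

definition lambda_2 :: "cube_const pts" where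
  "lambda_2 = cube {(StarC, StarC, StarC), (BoxC, StarC, StarC)}"

definition lambda_weak_omega :: "cube_const pts" where
  "lambda_weak_omega = cube {(StarC, StarC, StarC), (BoxC, BoxC, BoxC)}"

definition lambda_omega :: "cube_const pts" where
  "lambda_omega = cube {(StarC, StarC, StarC), (BoxC, StarC, StarC), (BoxC, BoxC, BoxC)}"

definition lambda_P2 :: "cube_const pts" where
  "lambda_P2 = cube {(StarC, StarC, StarC), (BoxC, StarC, StarC), (StarC, BoxC, BoxC)}"

definition lambda_P_weak_omega :: "cube_const pts" where
  "lambda_P_weak_omega = cube {(StarC, StarC, StarC), (StarC, BoxC, BoxC), (BoxC, BoxC, BoxC)}"

definition lambda_C :: "cube_const pts" where
  "lambda_C = cube {(StarC, StarC, StarC), (StarC, BoxC, BoxC), (BoxC, StarC, StarC),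
     (BoxC, BoxC, BoxC)}"

datatype tri_const = Star | Box | Triangle

definition lambda_AUT68 :: "tri_const pts" where
  "lambda_AUT68 = \<lparr>sorts = {Star, Box, Triangle}, axioms = {(Star, Box)},
     rules = {(Star, Star, Star), (Star, Box, Triangle), (Box, Star, Triangle),
       (Box, Box, Triangle), (Star, Triangle, Triangle), (Box, Triangle, Triangle)}\<rparr>"

definition lambda_AUTQE :: "tri_const pts" where
  "lambda_AUTQE = \<lparr>sorts = {Star, Box, Triangle}, axioms = {(Star, Box)},
     rules = {(Star, Star, Star), (Star, Box, Box), (Box, Star, Triangle),
       (Box, Box, Triangle), (Star, Triangle, Triangle), (Box, Triangle, Triangle)}\<rparr>"

definition lambda_PAL :: "tri_const pts" where
  "lambda_PAL = \<lparr>sorts = {Star, Box, Triangle}, axioms = {(Star, Box)},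
     rules = {(Star, Star, Triangle), (Star, Box, Triangle), (Box, Star, Triangle),
       (Box, Box, Triangle), (Star, Triangle, Triangle), (Box, Triangle, Triangle)}\<rparr>"

definition lambda_U :: "tri_const pts" where
  "lambda_U = \<lparr>sorts = {Star, Box, Triangle}, axioms = {(Star, Box), (Box, Triangle)},
     rules = {(Star, Star, Star), (Box, Star, Star), (Box, Box, Box),
       (Triangle, Box, Box), (Triangle, Star, Star)}\<rparr>"

definition lambda_HOL :: "tri_const pts" where
  "lambda_HOL = \<lparr>sorts = {Star, Box, Triangle}, axioms = {(Star, Box), (Box, Triangle)},
     rules = {(Star, Star, Star), (Box, Star, Star), (Box, Box, Box)}\<rparr>"

lemma wf_pts_systems:
  "wf_pts lambda_tau" "wf_pts lambda_2" "wf_pts lambda_omega" "wf_pts lambda_weak_omega"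
  "wf_pts lambda_P2" "wf_pts lambda_P_weak_omega" "wf_pts lambda_C" "wf_pts lambda_AUT68"
  "wf_pts lambda_AUTQE" "wf_pts lambda_PAL" "wf_pts lambda_U" "wf_pts lambda_HOL"
  by (simp_all add: wf_pts_def cube_def lambda_tau_def lambda_2_def lambda_omega_def
      lambda_weak_omega_def lambda_P2_def lambda_P_weak_omega_def lambda_C_def lambda_AUT68_def
      lambda_AUTQE_def lambda_PAL_def lambda_U_def lambda_HOL_def)

end

theory Submission
  imports Defs "HOL-Library.Confluence"
begin

text \<open>
  Let \<open>T\<close> be a set of sorts such that no rule \<open>(s\<^sub>1, t', s\<^sub>3)\<close> has a second component \<open>t'\<close> that
  types a sort \<open>t\<close> in \<open>T\<close>. Then an application \<open>F N\<close> never inhabits a sort \<open>t\<close> in \<open>T\<close>: if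
  \<open>F : \<Pi>x:A. B\<close> and \<open>B : t'\<close>, then \<open>B[N]\<close> reduces to \<open>t\<close>, and subject reduction gives \<open>t : t'\<close>.
  Hence an equivalent Hilbert-style system derives \<open>M : t\<close> only for reducts \<open>M\<close> of the subjects of
  its axioms, and up to the choice of sorts these are finitely many.

  On the other hand \<open>T\<close> is inhabited by towers \<open>\<Pi>x\<^sub>1:K. \<dots> \<Pi>x\<^sub>n:K. E\<close> of every height \<open>n\<close>. Products of a
  tower cannot be created by reduction: the inner towers are also typed by sorts in \<open>T\<close>, so by
  subject reduction every term along the spine of a typable \<open>M\<close> reducing to the tower inhabits a
  sort in \<open>T\<close> and is itself a product. So \<open>n\<close> is at most the size of \<open>M\<close>, which is bounded
  over the axioms.
\<close>


section \<open>Simultaneous substitution\<close>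

definition ups :: "(nat \<Rightarrow> 'c pterm) \<Rightarrow> nat \<Rightarrow> 'c pterm" where
  "ups \<sigma> = case_nat (Var 0) (\<lambda>i. lift 0 (\<sigma> i))"

text \<open>Acting on all indices at once makes \<open>lift\<close> and \<open>subst\<close>
  instances of one operation, so that a single composition law replaces the commutation lemmas with
  index arithmetic.\<close>

primrec psubst :: "(nat \<Rightarrow> 'c pterm) \<Rightarrow> 'c pterm \<Rightarrow> 'c pterm" where
  "psubst \<sigma> (Var i) = \<sigma> i"
| "psubst \<sigma> (Const c) = Const c"
| "psubst \<sigma> (Pi A B) = Pi (psubst \<sigma> A) (psubst (ups \<sigma>) B)"
| "psubst \<sigma> (Lam A M) = Lam (psubst \<sigma> A) (psubst (ups \<sigma>) M)"
| "psubst \<sigma> (App M N) = App (psubst \<sigma> M) (psubst \<sigma> N)"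

lemma ups_simps [simp]: "ups \<sigma> 0 = Var 0" "ups \<sigma> (Suc i) = lift 0 (\<sigma> i)"
  by (simp_all add: ups_def)

lemma ups_Var: "ups Var = Var"
proof
  show "ups Var i = Var i" for i by (cases i) auto
qed

lemma psubst_Var [simp]: "psubst Var M = M"
  by (induction M) (simp_all add: ups_Var)

lemma ups_lift:
  "ups (\<lambda>i. if i < k then Var i else Var (Suc i)) =
    (\<lambda>i. if i < Suc k then Var i else Var (Suc i))"
  by (auto simp: fun_eq_iff ups_def split: nat.split)

lemma lift_eq_psubst: "lift k M = psubst (\<lambda>i. if i < k then Var i else Var (Suc i)) M"
  by (induction M arbitrary: k) (simp_all add: ups_lift)

lemma lift_0_eq_psubst: "lift 0 M = psubst (\<lambda>i. Var (Suc i)) M"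
  by (simp add: lift_eq_psubst)

lemma ups_subst:
  "ups (\<lambda>i. if i < k then Var i else if i = k then N else Var (i - 1)) =
    (\<lambda>i. if i < Suc k then Var i else if i = Suc k then lift 0 N else Var (i - 1))"
  by (auto simp: fun_eq_iff ups_def split: nat.split)

lemma subst_eq_psubst:
  "subst M N k = psubst (\<lambda>i. if i < k then Var i else if i = k then N else Var (i - 1)) M"
  by (induction M arbitrary: N k) (simp_all only: subst.simps psubst.simps ups_subst)

lemma subst_0_eq_psubst: "subst M N 0 = psubst (case_nat N Var) M"
proof -
  have "(\<lambda>i. if i < 0 then Var i else if i = 0 then N else Var (i - 1)) = case_nat N Var"
    by (auto split: nat.split)
  then show ?thesis by (simp only: subst_eq_psubst)
qed

section \<open>Composition of renamings and substitutions\<close>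

lemma ups_rename: "ups (\<lambda>i. Var (\<rho> i)) = (\<lambda>i. Var (case_nat 0 (\<lambda>i. Suc (\<rho> i)) i))"
  by (auto simp: fun_eq_iff ups_def split: nat.split)

lemma ups_comp: "(\<lambda>i. ups \<sigma> (case_nat 0 (\<lambda>i. Suc (\<rho> i)) i)) = ups (\<lambda>i. \<sigma> (\<rho> i))"
  by (auto simp: fun_eq_iff ups_def split: nat.split)

text \<open>Under a binder, composition has to commute with \<open>ups\<close>, which itself applies
  the renaming \<open>lift 0\<close>. So the law comes in stages: an inner renaming, then an outer
  renaming, then two arbitrary substitutions.\<close>

lemma psubst_rename: "psubst \<sigma> (psubst (\<lambda>i. Var (\<rho> i)) M) = psubst (\<lambda>i. \<sigma> (\<rho> i)) M"
  by (induction M arbitrary: \<sigma> \<rho>) (simp_all only: psubst.simps ups_rename ups_comp)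

lemma psubst_lift: "psubst \<sigma> (lift 0 M) = psubst (\<lambda>i. \<sigma> (Suc i)) M"
  by (simp only: lift_0_eq_psubst psubst_rename)

lemma rename_ups:
  "(\<lambda>i. psubst (\<lambda>j. Var (case_nat 0 (\<lambda>i. Suc (\<rho> i)) j)) (ups \<sigma> i)) =
    ups (\<lambda>i. psubst (\<lambda>j. Var (\<rho> j)) (\<sigma> i))"
proof
  show "psubst (\<lambda>j. Var (case_nat 0 (\<lambda>i. Suc (\<rho> i)) j)) (ups \<sigma> i) =
      ups (\<lambda>i. psubst (\<lambda>j. Var (\<rho> j)) (\<sigma> i)) i" for i
    by (cases i) (simp_all add: lift_0_eq_psubst psubst_rename)
qed

lemma rename_psubst:
  "psubst (\<lambda>i. Var (\<rho> i)) (psubst \<sigma> M) = psubst (\<lambda>i. psubst (\<lambda>j. Var (\<rho> j)) (\<sigma> i)) M"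
  by (induction M arbitrary: \<sigma> \<rho>) (simp_all only: psubst.simps ups_rename rename_ups)

lemma psubst_lift_comp: "psubst (\<lambda>i. lift 0 (\<sigma> i)) M = lift 0 (psubst \<sigma> M)"
  by (simp only: lift_0_eq_psubst rename_psubst)

lemma psubst_ups: "(\<lambda>i. psubst (ups \<tau>) (ups \<sigma> i)) = ups (\<lambda>i. psubst \<tau> (\<sigma> i))"
proof
  show "psubst (ups \<tau>) (ups \<sigma> i) = ups (\<lambda>i. psubst \<tau> (\<sigma> i)) i" for i
    by (cases i) (simp_all add: psubst_lift psubst_lift_comp)
qed

lemma psubst_psubst: "psubst \<tau> (psubst \<sigma> M) = psubst (\<lambda>i. psubst \<tau> (\<sigma> i)) M"
  by (induction M arbitrary: \<sigma> \<tau>) (simp_all only: psubst.simps psubst_ups)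

text \<open>Both sides are one substitution in \<open>B\<close>: it sends index 0 to
  \<open>psubst \<sigma> N\<close> and acts as \<sigma> on the remaining indices.\<close>

lemma psubst_subst: "psubst \<sigma> (subst B N 0) = subst (psubst (ups \<sigma>) B) (psubst \<sigma> N) 0"
proof -
  have "(\<lambda>i. psubst \<sigma> (case_nat N Var i)) =
      (\<lambda>i. psubst (case_nat (psubst \<sigma> N) Var) (ups \<sigma> i))"
    by (rule ext) (simp add: psubst_lift ups_def split: nat.split)
  then show ?thesis by (simp add: subst_0_eq_psubst psubst_psubst)
qed


section \<open>Confluence of reduction\<close>

lemma beta_psubst: "M \<rightarrow>\<^sub>\<beta> N \<Longrightarrow> psubst \<sigma> M \<rightarrow>\<^sub>\<beta> psubst \<sigma> N"
  by (induction arbitrary: \<sigma> rule: beta.induct) (auto intro: beta.intros simp: psubst_subst)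

lemma betas_Pi: "beta\<^sup>*\<^sup>* A A' \<Longrightarrow> beta\<^sup>*\<^sup>* B B' \<Longrightarrow> beta\<^sup>*\<^sup>* (Pi A B) (Pi A' B')"
proof -
  assume A: "beta\<^sup>*\<^sup>* A A'" and B: "beta\<^sup>*\<^sup>* B B'"
  have "beta\<^sup>*\<^sup>* (Pi A B) (Pi A' B)"
    using A by induction (auto intro: beta.intros rtranclp.rtrancl_into_rtrancl)
  moreover have "beta\<^sup>*\<^sup>* (Pi A' B) (Pi A' B')"
    using B by induction (auto intro: beta.intros rtranclp.rtrancl_into_rtrancl)
  ultimately show ?thesis by (rule rtranclp_trans)
qed

lemma betas_Lam: "beta\<^sup>*\<^sup>* A A' \<Longrightarrow> beta\<^sup>*\<^sup>* B B' \<Longrightarrow> beta\<^sup>*\<^sup>* (Lam A B) (Lam A' B')"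
proof -
  assume A: "beta\<^sup>*\<^sup>* A A'" and B: "beta\<^sup>*\<^sup>* B B'"
  have "beta\<^sup>*\<^sup>* (Lam A B) (Lam A' B)"
    using A by induction (auto intro: beta.intros rtranclp.rtrancl_into_rtrancl)
  moreover have "beta\<^sup>*\<^sup>* (Lam A' B) (Lam A' B')"
    using B by induction (auto intro: beta.intros rtranclp.rtrancl_into_rtrancl)
  ultimately show ?thesis by (rule rtranclp_trans)
qed

lemma betas_App: "beta\<^sup>*\<^sup>* A A' \<Longrightarrow> beta\<^sup>*\<^sup>* B B' \<Longrightarrow> beta\<^sup>*\<^sup>* (App A B) (App A' B')"
proof -
  assume A: "beta\<^sup>*\<^sup>* A A'" and B: "beta\<^sup>*\<^sup>* B B'"
  have "beta\<^sup>*\<^sup>* (App A B) (App A' B)"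
    using A by induction (auto intro: beta.intros rtranclp.rtrancl_into_rtrancl)
  moreover have "beta\<^sup>*\<^sup>* (App A' B) (App A' B')"
    using B by induction (auto intro: beta.intros rtranclp.rtrancl_into_rtrancl)
  ultimately show ?thesis by (rule rtranclp_trans)
qed

section \<open>Parallel reduction and complete developments\<close>

inductive par :: "'c pterm \<Rightarrow> 'c pterm \<Rightarrow> bool" (infix "\<Rrightarrow>" 50) where
  par_Var: "Var i \<Rrightarrow> Var i"
| par_Const: "Const c \<Rrightarrow> Const c"
| par_Pi: "A \<Rrightarrow> A' \<Longrightarrow> B \<Rrightarrow> B' \<Longrightarrow> Pi A B \<Rrightarrow> Pi A' B'"
| par_Lam: "A \<Rrightarrow> A' \<Longrightarrow> M \<Rrightarrow> M' \<Longrightarrow> Lam A M \<Rrightarrow> Lam A' M'"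
| par_App: "M \<Rrightarrow> M' \<Longrightarrow> N \<Rrightarrow> N' \<Longrightarrow> App M N \<Rrightarrow> App M' N'"
| par_redex: "M \<Rrightarrow> M' \<Longrightarrow> N \<Rrightarrow> N' \<Longrightarrow> App (Lam A M) N \<Rrightarrow> subst M' N' 0"

lemma par_refl [simp]: "M \<Rrightarrow> M"
  by (induction M) (auto intro: par.intros)

lemma beta_imp_par: "M \<rightarrow>\<^sub>\<beta> N \<Longrightarrow> M \<Rrightarrow> N"
  by (induction rule: beta.induct) (auto intro: par.intros)

lemma par_imp_betas: "M \<Rrightarrow> N \<Longrightarrow> beta\<^sup>*\<^sup>* M N"
proof (induction rule: par.induct)
  case (par_redex M M' N N' A)
  then have "beta\<^sup>*\<^sup>* (App (Lam A M) N) (App (Lam A M') N')"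
    by (intro betas_App betas_Lam) auto
  then show ?case by (meson beta_redex rtranclp.rtrancl_into_rtrancl)
qed (auto intro: betas_Pi betas_Lam betas_App)

lemma par_psubst_same: "M \<Rrightarrow> N \<Longrightarrow> psubst \<sigma> M \<Rrightarrow> psubst \<sigma> N"
  by (induction arbitrary: \<sigma> rule: par.induct) (auto intro: par.intros simp: psubst_subst)

lemma par_ups: "(\<And>i. \<sigma> i \<Rrightarrow> \<tau> i) \<Longrightarrow> ups \<sigma> i \<Rrightarrow> ups \<tau> i"
  by (cases i) (auto simp: lift_0_eq_psubst par_psubst_same)

lemma par_psubst: "M \<Rrightarrow> N \<Longrightarrow> (\<And>i. \<sigma> i \<Rrightarrow> \<tau> i) \<Longrightarrow> psubst \<sigma> M \<Rrightarrow> psubst \<tau> N"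
  by (induction arbitrary: \<sigma> \<tau> rule: par.induct)
    (auto intro: par.intros simp: psubst_subst par_ups)

lemma par_subst: "M \<Rrightarrow> M' \<Longrightarrow> N \<Rrightarrow> N' \<Longrightarrow> subst M N 0 \<Rrightarrow> subst M' N' 0"
  by (auto simp: subst_0_eq_psubst intro!: par_psubst split: nat.split)

fun complete_dev :: "'c pterm \<Rightarrow> 'c pterm" where
  "complete_dev (Var i) = Var i"
| "complete_dev (Const c) = Const c"
| "complete_dev (Pi A B) = Pi (complete_dev A) (complete_dev B)"
| "complete_dev (Lam A M) = Lam (complete_dev A) (complete_dev M)"
| "complete_dev (App (Lam A M) N) = subst (complete_dev M) (complete_dev N) 0"
| "complete_dev (App M N) = App (complete_dev M) (complete_dev N)"

inductive_cases par_LamE: "Lam A M \<Rrightarrow> N"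

text \<open>Takahashi's triangle property: the target depends on \<open>M\<close> alone, so it joins
  any two parallel reducts of \<open>M\<close> in one step each.\<close>

lemma par_complete_dev: "M \<Rrightarrow> N \<Longrightarrow> N \<Rrightarrow> complete_dev M"
proof (induction rule: par.induct)
  case (par_App M M' N N')
  show ?case
  \<comment> \<open>Only below an abstraction does \<open>complete_dev\<close> contract the
    application itself. The parallel reduct of the function part is then an abstraction too, so the
    missing contraction can still be done.\<close>
  proof (cases "\<exists>A K. M = Lam A K")
    case True
    then obtain A K where M: "M = Lam A K" by blast
    with par_App(1) obtain A' K' where M': "M' = Lam A' K'" by (auto elim: par_LamE)
    from par_App(3) have "K' \<Rrightarrow> complete_dev K" by (auto simp: M M' elim: par_LamE)
    with par_App(4) show ?thesis by (simp add: M M' par_redex)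
  next
    case False
    then have "complete_dev (App M N) = App (complete_dev M) (complete_dev N)"
      by (cases M) auto
    with par_App show ?thesis by (simp add: par.par_App)
  qed
qed (auto intro: par.intros par_subst)

lemma betas_eq_pars: "beta\<^sup>*\<^sup>* = par\<^sup>*\<^sup>*"
proof (rule antisym)
  show "beta\<^sup>*\<^sup>* \<le> par\<^sup>*\<^sup>*" by (rule rtranclp_mono) (auto simp: beta_imp_par)
  have "par\<^sup>*\<^sup>* \<le> beta\<^sup>*\<^sup>*\<^sup>*\<^sup>*" by (rule rtranclp_mono) (auto simp: par_imp_betas)
  then show "par\<^sup>*\<^sup>* \<le> beta\<^sup>*\<^sup>*" by simp
qed

lemma confluentp_beta: "confluentp beta"
proof -
  have "strong_confluentp par"
    by (rule strong_confluentpI) (use par_complete_dev in blast)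
  then have "confluentp par" by (rule strong_confluentp_imp_confluentp)
  then show ?thesis
    by (simp only: confluentp_def betas_eq_pars rtranclp_conversep)
qed

lemma Church_Rosser: "A =\<^sub>\<beta> B \<Longrightarrow> \<exists>C. beta\<^sup>*\<^sup>* A C \<and> beta\<^sup>*\<^sup>* B C"
  using semiconfluentp_equivclp[OF confluentp_imp_semiconfluentp[OF confluentp_beta]]
  by (auto simp: rtranclp_conversep dest: fun_cong)

section \<open>Consequences of confluence for constants and products\<close>

inductive_cases beta_ConstE: "Const c \<rightarrow>\<^sub>\<beta> M"
inductive_cases beta_VarE: "Var i \<rightarrow>\<^sub>\<beta> M"
inductive_cases beta_PiE: "Pi A B \<rightarrow>\<^sub>\<beta> M"

lemma betas_Const: "beta\<^sup>*\<^sup>* (Const c) M \<Longrightarrow> M = Const c"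
  by (induction rule: rtranclp_induct) (auto elim: beta_ConstE)

lemma betas_Var: "beta\<^sup>*\<^sup>* (Var i) M \<Longrightarrow> M = Var i"
  by (induction rule: rtranclp_induct) (auto elim: beta_VarE)

lemma betas_Pi_left:
  "beta\<^sup>*\<^sup>* (Pi A B) M \<Longrightarrow> \<exists>A' B'. M = Pi A' B' \<and> beta\<^sup>*\<^sup>* A A' \<and> beta\<^sup>*\<^sup>* B B'"
  by (induction rule: rtranclp_induct)
    (auto elim!: beta_PiE intro: rtranclp.rtrancl_into_rtrancl)

lemma beta_eq_Const: "M =\<^sub>\<beta> Const c \<Longrightarrow> beta\<^sup>*\<^sup>* M (Const c)"
  by (auto dest!: Church_Rosser betas_Const)

lemma Const_beta_eq_Const [simp]: "Const c =\<^sub>\<beta> Const d \<longleftrightarrow> c = d"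
  by (auto dest!: beta_eq_Const betas_Const)

lemma Pi_beta_eq_Const [simp]: "\<not> Pi A B =\<^sub>\<beta> Const c"
  by (auto dest!: beta_eq_Const betas_Pi_left)

text \<open>Reduction never destroys an outer product, so a common reduct is a product whose
  components are common reducts.\<close>

lemma Pi_beta_eq_PiD: "Pi A B =\<^sub>\<beta> Pi A' B' \<Longrightarrow> A =\<^sub>\<beta> A' \<and> B =\<^sub>\<beta> B'"
  by (blast dest!: Church_Rosser betas_Pi_left
      intro: equivclp_trans rtranclp_into_equivclp converse_rtranclp_into_equivclp)

lemma betas_psubst: "beta\<^sup>*\<^sup>* M N \<Longrightarrow> beta\<^sup>*\<^sup>* (psubst \<sigma> M) (psubst \<sigma> N)"
  by (induction rule: rtranclp_induct) (auto intro: rtranclp.rtrancl_into_rtrancl beta_psubst)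

lemma beta_eq_psubst:
  assumes "M =\<^sub>\<beta> N" shows "psubst \<sigma> M =\<^sub>\<beta> psubst \<sigma> N"
proof -
  obtain C where "beta\<^sup>*\<^sup>* M C" "beta\<^sup>*\<^sup>* N C" using Church_Rosser[OF assms] by blast
  then show ?thesis
    by (meson betas_psubst converse_rtranclp_into_equivclp equivclp_trans rtranclp_into_equivclp)
qed

lemma beta_eq_lift: "M =\<^sub>\<beta> N \<Longrightarrow> lift 0 M =\<^sub>\<beta> lift 0 N"
  by (simp add: lift_0_eq_psubst beta_eq_psubst)

lemma beta_eq_Pi:
  assumes "A =\<^sub>\<beta> A'" "B =\<^sub>\<beta> B'" shows "Pi A B =\<^sub>\<beta> Pi A' B'"
proof -
  obtain C D where "beta\<^sup>*\<^sup>* A C" "beta\<^sup>*\<^sup>* A' C" "beta\<^sup>*\<^sup>* B D" "beta\<^sup>*\<^sup>* B' D"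
    using assms Church_Rosser by meson
  then show ?thesis
    by (meson betas_Pi converse_rtranclp_into_equivclp equivclp_trans rtranclp_into_equivclp)
qed

lemma beta_eq_subst_left: "B =\<^sub>\<beta> B' \<Longrightarrow> subst B N 0 =\<^sub>\<beta> subst B' N 0"
  by (simp add: subst_0_eq_psubst beta_eq_psubst)

text \<open>The step in \<open>N\<close> may be copied to many places or erased; a single parallel
  step covers all cases.\<close>

lemma beta_eq_subst_right: "N \<rightarrow>\<^sub>\<beta> N' \<Longrightarrow> subst B N 0 =\<^sub>\<beta> subst B N' 0"
  by (intro rtranclp_into_equivclp par_imp_betas par_subst beta_imp_par par_refl)


section \<open>Metatheory of pure type systems\<close>

locale pure_type_system =
  fixes P :: "'c pts"
  assumes wf: "wf_pts P"
begin

lemma rules_in_sorts: "(s1, s2, s3) \<in> rules P \<Longrightarrow> s1 \<in> sorts P \<and> s2 \<in> sorts P \<and> s3 \<in> sorts P"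
  using wf by (auto simp: wf_pts_def)

lemma axioms_in_sorts: "(c, s) \<in> axioms P \<Longrightarrow> s \<in> sorts P"
  using wf by (auto simp: wf_pts_def)

definition is_type :: "'c pterm list \<Rightarrow> 'c pterm \<Rightarrow> bool" where
  "is_type \<Gamma> A \<longleftrightarrow> (\<exists>s \<in> sorts P. typing P \<Gamma> A (Const s))"

primrec valid :: "'c pterm list \<Rightarrow> bool" where
  "valid [] = True"
| "valid (A # \<Gamma>) = (is_type \<Gamma> A \<and> valid \<Gamma>)"

text \<open>A well-typed substitution from the second context into the first. The head entry lives
  in the tail of its context, hence the shift of \<sigma> in its type.\<close>

primrec morphism :: "'c pterm list \<Rightarrow> 'c pterm list \<Rightarrow> (nat \<Rightarrow> 'c pterm) \<Rightarrow> bool" where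
  "morphism \<Delta> [] \<sigma> = True"
| "morphism \<Delta> (A # \<Gamma>) \<sigma> =
    (typing P \<Delta> (\<sigma> 0) (psubst (\<lambda>i. \<sigma> (Suc i)) A) \<and> morphism \<Delta> \<Gamma> (\<lambda>i. \<sigma> (Suc i)))"

definition substitutive :: "'c pterm list \<Rightarrow> 'c pterm \<Rightarrow> 'c pterm \<Rightarrow> bool" where
  "substitutive \<Gamma> M A \<longleftrightarrow>
    (\<forall>\<Delta> \<sigma>. valid \<Delta> \<longrightarrow> morphism \<Delta> \<Gamma> \<sigma> \<longrightarrow> typing P \<Delta> (psubst \<sigma> M) (psubst \<sigma> A))"

primrec substitutive_context :: "'c pterm list \<Rightarrow> bool" where
  "substitutive_context [] = True"
| "substitutive_context (A # \<Gamma>) =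
    ((\<exists>s \<in> sorts P. substitutive \<Gamma> A (Const s)) \<and> substitutive_context \<Gamma>)"

lemma typing_valid: "typing P \<Gamma> M A \<Longrightarrow> valid \<Gamma>"
  by (induction rule: typing.induct) (auto simp: is_type_def)

text \<open>The axiom rule works in the empty context only; repeated weakening carries it through a
  valid one.\<close>

lemma typing_axiom_valid: "valid \<Gamma> \<Longrightarrow> (c, s) \<in> axioms P \<Longrightarrow> typing P \<Gamma> (Const c) (Const s)"
proof (induction \<Gamma>)
  case (Cons A \<Gamma>)
  then show ?case using weakening[of P \<Gamma> "Const c" "Const s" A] by (auto simp: is_type_def)
qed (simp add: ax)

lemma morphism_weaken: "morphism \<Delta> \<Gamma> \<sigma> \<Longrightarrow> is_type \<Delta> A \<Longrightarrow> morphism (A # \<Delta>) \<Gamma> (\<lambda>i. lift 0 (\<sigma> i))"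
proof (induction \<Gamma> arbitrary: \<sigma>)
  case (Cons B \<Gamma>)
  then have "typing P (A # \<Delta>) (lift 0 (\<sigma> 0)) (lift 0 (psubst (\<lambda>i. \<sigma> (Suc i)) B))"
    by (auto simp: is_type_def intro: weakening)
  with Cons show ?case by (simp add: psubst_lift_comp)
qed simp

lemma morphism_ups:
  "morphism \<Delta> \<Gamma> \<sigma> \<Longrightarrow> is_type \<Delta> (psubst \<sigma> A) \<Longrightarrow> morphism (psubst \<sigma> A # \<Delta>) (A # \<Gamma>) (ups \<sigma>)"
  by (auto simp: psubst_lift_comp morphism_weaken is_type_def intro: start)

text \<open>
  The premise of (abstraction) about \<open>A # \<Gamma>\<close> can only be used after \<open>A\<close> has been typed in the
  target context, so the induction also carries the claim for all entries of the context.
\<close>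

lemma typing_substitutive: "typing P \<Gamma> M A \<Longrightarrow> substitutive_context \<Gamma> \<and> substitutive \<Gamma> M A"
proof (induction rule: typing.induct)
  case (ax c s)
  then show ?case by (simp add: substitutive_def typing_axiom_valid)
next
  case (start \<Gamma> A s)
  then show ?case by (auto simp: substitutive_def psubst_lift)
next
  case (weakening \<Gamma> M B A s)
  then show ?case by (auto simp: substitutive_def psubst_lift)
next
  case (application \<Gamma> M A B N)
  then show ?case
    by (auto simp: substitutive_def psubst_subst intro!: typing.application)
next
  case (abstraction A \<Gamma> M B s)
  have "typing P \<Delta> (Lam (psubst \<sigma> A) (psubst (ups \<sigma>) M)) (Pi (psubst \<sigma> A) (psubst (ups \<sigma>) B))"
    if "valid \<Delta>" "morphism \<Delta> \<Gamma> \<sigma>" for \<Delta> \<sigma>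
  proof (rule typing.abstraction[where s = s])
    have t: "is_type \<Delta> (psubst \<sigma> A)"
      using abstraction.IH(1) that by (auto simp: substitutive_def is_type_def)
    then show "typing P (psubst \<sigma> A # \<Delta>) (psubst (ups \<sigma>) M) (psubst (ups \<sigma>) B)"
      using abstraction.IH(1) that morphism_ups[OF that(2) t] by (auto simp: substitutive_def)
    show "typing P \<Delta> (Pi (psubst \<sigma> A) (psubst (ups \<sigma>) B)) (Const s)"
      using abstraction.IH(2) that by (auto simp: substitutive_def)
  qed (fact abstraction.hyps)
  with abstraction show ?case by (simp add: substitutive_def)
next
  case (product A \<Gamma> B s2 s1 s3)
  have "typing P \<Delta> (Pi (psubst \<sigma> A) (psubst (ups \<sigma>) B)) (Const s3)"
    if "valid \<Delta>" "morphism \<Delta> \<Gamma> \<sigma>" for \<Delta> \<sigma>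
  proof (rule typing.product[where ?s1.0 = s1 and ?s2.0 = s2])
    have t: "is_type \<Delta> (psubst \<sigma> A)"
      using product.IH(1) that by (auto simp: substitutive_def is_type_def)
    then show "typing P (psubst \<sigma> A # \<Delta>) (psubst (ups \<sigma>) B) (Const s2)"
      using product.IH(1) that morphism_ups[OF that(2) t] by (auto simp: substitutive_def)
    show "typing P \<Delta> (psubst \<sigma> A) (Const s1)"
      using product.IH(2) that by (auto simp: substitutive_def)
  qed (fact product.hyps)
  with product show ?case by (simp add: substitutive_def)
next
  case (conversion \<Gamma> M A B s)
  have "typing P \<Delta> (psubst \<sigma> M) (psubst \<sigma> B)" if "valid \<Delta>" "morphism \<Delta> \<Gamma> \<sigma>" for \<Delta> \<sigma>
  proof (rule typing.conversion[where A = "psubst \<sigma> A" and s = s])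
    show "typing P \<Delta> (psubst \<sigma> M) (psubst \<sigma> A)" "typing P \<Delta> (psubst \<sigma> B) (Const s)"
      using conversion.IH that by (auto simp: substitutive_def)
    show "psubst \<sigma> A =\<^sub>\<beta> psubst \<sigma> B" using conversion.hyps by (simp add: beta_eq_psubst)
  qed (fact conversion.hyps)
  with conversion show ?case by (simp add: substitutive_def)
qed

section \<open>Typing under substitutions and changes of context\<close>

lemma typing_psubst:
  "typing P \<Gamma> M A \<Longrightarrow> valid \<Delta> \<Longrightarrow> morphism \<Delta> \<Gamma> \<sigma> \<Longrightarrow> typing P \<Delta> (psubst \<sigma> M) (psubst \<sigma> A)"
  using typing_substitutive by (auto simp: substitutive_def)

lemma morphism_Var: "valid \<Gamma> \<Longrightarrow> morphism \<Gamma> \<Gamma> Var"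
proof (induction \<Gamma>)
  case (Cons A \<Gamma>)
  then have "morphism (A # \<Gamma>) (A # \<Gamma>) (ups Var)"
    by (metis morphism_ups psubst_Var valid.simps(2))
  then show ?case by (simp only: ups_Var)
qed simp

lemma typing_subst:
  assumes "typing P (A # \<Gamma>) M B" "typing P \<Gamma> N A"
  shows "typing P \<Gamma> (subst M N 0) (subst B N 0)"
proof -
  have "morphism \<Gamma> (A # \<Gamma>) (case_nat N Var)"
    using assms by (simp add: morphism_Var typing_valid)
  with assms typing_valid[OF assms(2)] show ?thesis
    by (simp only: subst_0_eq_psubst typing_psubst)
qed

text \<open>The identity substitution is a morphism between the two contexts, since by conversion
  index 0 has the old type in the new context as well.\<close>

lemma typing_context_conversion:
  assumes "typing P (A # \<Gamma>) M B" "is_type \<Gamma> A'" "A =\<^sub>\<beta> A'"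
  shows "typing P (A' # \<Gamma>) M B"
proof -
  have v: "valid (A # \<Gamma>)" using assms(1) by (rule typing_valid)
  then obtain s where s: "s \<in> sorts P" "typing P \<Gamma> A (Const s)" by (auto simp: is_type_def)
  have "typing P (A' # \<Gamma>) (Var 0) (lift 0 A)"
  proof (rule conversion)
    show "typing P (A' # \<Gamma>) (Var 0) (lift 0 A')" using assms(2) by (auto simp: is_type_def intro: start)
    show "typing P (A' # \<Gamma>) (lift 0 A) (Const s)"
      using weakening[OF s(2)] assms(2) by (auto simp: is_type_def)
    show "lift 0 A' =\<^sub>\<beta> lift 0 A"
      using equivclp_sym[OF assms(3)] by (rule beta_eq_lift)
  qed (fact s)
  moreover have "morphism (A' # \<Gamma>) \<Gamma> (\<lambda>i. Var (Suc i))"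
    using morphism_weaken[OF morphism_Var assms(2)] v by simp
  ultimately have "morphism (A' # \<Gamma>) (A # \<Gamma>) Var"
    by (simp add: lift_0_eq_psubst)
  from typing_psubst[OF assms(1) _ this] v assms(2) show ?thesis by simp
qed

lemma is_type_weaken:
  assumes "is_type \<Gamma> A" "is_type \<Gamma> D"
  shows "is_type (D # \<Gamma>) (lift 0 A)"
proof -
  obtain s s' where "typing P \<Gamma> A (Const s)" "typing P \<Gamma> D (Const s')" "s \<in> sorts P" "s' \<in> sorts P"
    using assms by (auto simp: is_type_def)
  from weakening[OF this(1,2,4)] this(3) show ?thesis by (auto simp: is_type_def)
qed

text \<open>(weakening) inserts a declaration only at the head of a context. Insertion below one
  binder is the substitution lemma for \<open>ups\<close> of the shift; inverting products and
  abstractions needs it.\<close>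

lemma typing_weaken_binder:
  assumes "typing P (A # \<Gamma>) M B" "is_type \<Gamma> D"
  shows "typing P (lift 0 A # D # \<Gamma>) (lift 1 M) (lift 1 B)"
proof -
  have v: "valid (A # \<Gamma>)" using assms(1) by (rule typing_valid)
  have m: "morphism (D # \<Gamma>) \<Gamma> (\<lambda>i. Var (Suc i))"
    using morphism_weaken[OF morphism_Var assms(2)] v by simp
  have t: "is_type (D # \<Gamma>) (psubst (\<lambda>i. Var (Suc i)) A)"
    using v assms(2) is_type_weaken by (simp flip: lift_0_eq_psubst)
  have "typing P (lift 0 A # D # \<Gamma>) (psubst (ups (\<lambda>i. Var (Suc i))) M) (psubst (ups (\<lambda>i. Var (Suc i))) B)"
    using typing_psubst[OF assms(1) _ morphism_ups[OF m t]] t v assms(2)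
    by (simp add: lift_0_eq_psubst)
  moreover have "ups (\<lambda>i. Var (Suc i) :: 'c pterm) = (\<lambda>i. if i < 1 then Var i else Var (Suc i))"
    by (auto simp: fun_eq_iff ups_def split: nat.split)
  ultimately show ?thesis by (simp only: lift_eq_psubst[of 1])
qed

text \<open>
  The type found by inverting a derivation determines the actual type only up to
  conversion. The second conjunct keeps the conversion rule applicable: top sorts are not
  typable themselves.
\<close>

definition converts :: "'c pterm list \<Rightarrow> 'c pterm \<Rightarrow> 'c pterm \<Rightarrow> bool" where
  "converts \<Gamma> A B \<longleftrightarrow> A =\<^sub>\<beta> B \<and> (A = B \<or> is_type \<Gamma> B)"

lemma converts_refl [simp]: "converts \<Gamma> A A"
  by (simp add: converts_def)

lemma typing_conversion: "typing P \<Gamma> M A \<Longrightarrow> is_type \<Gamma> B \<Longrightarrow> A =\<^sub>\<beta> B \<Longrightarrow> typing P \<Gamma> M B"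
  by (auto simp: is_type_def intro: conversion)

lemma typing_converts: "typing P \<Gamma> M A \<Longrightarrow> converts \<Gamma> A B \<Longrightarrow> typing P \<Gamma> M B"
  by (auto simp: converts_def is_type_def intro: conversion)

lemma converts_conversion:
  "converts \<Gamma> A B \<Longrightarrow> B =\<^sub>\<beta> C \<Longrightarrow> is_type \<Gamma> C \<Longrightarrow> converts \<Gamma> A C"
  by (auto simp: converts_def intro: equivclp_trans)

lemma converts_weaken: "converts \<Gamma> A B \<Longrightarrow> is_type \<Gamma> D \<Longrightarrow> converts (D # \<Gamma>) (lift 0 A) (lift 0 B)"
  by (auto simp: converts_def is_type_weaken beta_eq_lift)

section \<open>Inversion of typing judgements and correctness of types\<close>

lemma typing_ConstD: "typing P \<Gamma> (Const c) C \<Longrightarrow> \<exists>s. (c, s) \<in> axioms P \<and> converts \<Gamma> (Const s) C"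
proof (induction \<Gamma> "Const c" C rule: typing.induct)
  case (weakening \<Gamma> M B A s)
  then have "M = Const c" by (cases M) (auto split: if_splits)
  with weakening obtain s' where "(c, s') \<in> axioms P" "converts \<Gamma> (Const s') B" by blast
  with weakening show ?case using converts_weaken[of \<Gamma> "Const s'" B A] by (auto simp: is_type_def)
next
  case (conversion \<Gamma> A B s)
  then show ?case by (meson converts_conversion is_type_def)
qed auto

text \<open>(weakening) cannot end such a derivation, as \<open>lift 0\<close> never yields index 0;
  only (start) followed by conversions remains.\<close>

lemma typing_Var0D: "typing P (K # \<Gamma>) (Var 0) C \<Longrightarrow> lift 0 K =\<^sub>\<beta> C"
proof (induction "K # \<Gamma>" "Var 0 :: 'c pterm" C rule: typing.induct)
  case (weakening M B s)
  then show ?case by (cases M) (auto split: if_splits)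
next
  case (conversion A B s)
  then show ?case by (blast intro: equivclp_trans)
qed auto

lemma typing_PiD:
  "typing P \<Gamma> (Pi A B) C \<Longrightarrow> \<exists>s1 s2 s3. (s1, s2, s3) \<in> rules P \<and> typing P \<Gamma> A (Const s1) \<and>
    typing P (A # \<Gamma>) B (Const s2) \<and> converts \<Gamma> (Const s3) C"
proof (induction \<Gamma> "Pi A B" C arbitrary: A B rule: typing.induct)
  case (weakening \<Gamma> M C D s)
  then obtain A0 B0 where M: "M = Pi A0 B0" and AB: "A = lift 0 A0" "B = lift 1 B0"
    by (cases M) (auto split: if_splits)
  have D: "is_type \<Gamma> D" using weakening by (auto simp: is_type_def)
  from weakening(2)[OF M] obtain s1 s2 s3 where *: "(s1, s2, s3) \<in> rules P"
    "typing P \<Gamma> A0 (Const s1)" "typing P (A0 # \<Gamma>) B0 (Const s2)" "converts \<Gamma> (Const s3) C" by blast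
  have "typing P (D # \<Gamma>) A (Const s1)"
    using typing.weakening[OF *(2) weakening(3,5)] by (simp add: AB)
  moreover have "typing P (A # D # \<Gamma>) B (Const s2)"
    using typing_weaken_binder[OF *(3) D] by (simp add: AB)
  moreover have "converts (D # \<Gamma>) (Const s3) (lift 0 C)"
    using converts_weaken[OF *(4) D] by simp
  ultimately show ?case using *(1) by blast
next
  case (product A \<Gamma> B s2 s1 s3)
  then show ?case using converts_refl by blast
next
  case (conversion \<Gamma> C C' s)
  then show ?case by (meson converts_conversion is_type_def)
qed

lemma typing_LamD:
  "typing P \<Gamma> (Lam A M) C \<Longrightarrow> \<exists>B. typing P (A # \<Gamma>) M B \<and> is_type \<Gamma> (Pi A B) \<and>
    converts \<Gamma> (Pi A B) C"
proof (induction \<Gamma> "Lam A M" C arbitrary: A M rule: typing.induct)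
  case (weakening \<Gamma> X C D s)
  then obtain A0 M0 where X: "X = Lam A0 M0" and AM: "A = lift 0 A0" "M = lift 1 M0"
    by (cases X) (auto split: if_splits)
  have D: "is_type \<Gamma> D" using weakening by (auto simp: is_type_def)
  from weakening(2)[OF X] obtain B where *:
    "typing P (A0 # \<Gamma>) M0 B" "is_type \<Gamma> (Pi A0 B)" "converts \<Gamma> (Pi A0 B) C" by blast
  have "typing P (A # D # \<Gamma>) M (lift 1 B)"
    using typing_weaken_binder[OF *(1) D] by (simp add: AM)
  moreover have "is_type (D # \<Gamma>) (Pi A (lift 1 B))"
    using is_type_weaken[OF *(2) D] by (simp add: AM)
  moreover have "converts (D # \<Gamma>) (Pi A (lift 1 B)) (lift 0 C)"
    using converts_weaken[OF *(3) D] by (simp add: AM)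
  ultimately show ?case by blast
next
  case (abstraction A \<Gamma> M B s)
  then show ?case using converts_refl by (auto simp: is_type_def)
next
  case (conversion \<Gamma> C C' s)
  then show ?case by (meson converts_conversion is_type_def)
qed

lemma is_type_subst:
  assumes "is_type \<Gamma> (Pi A B)" "typing P \<Gamma> N A"
  shows "is_type \<Gamma> (subst B N 0)"
proof -
  obtain s1 s2 s3 where "(s1, s2, s3) \<in> rules P" "typing P (A # \<Gamma>) B (Const s2)"
    using assms(1) typing_PiD unfolding is_type_def by meson
  then show ?thesis
    using typing_subst[OF _ assms(2), of B "Const s2"] rules_in_sorts by (auto simp: is_type_def)
qed

text \<open>The first alternative covers sorts that no axiom types: they can be types without having
  one.\<close>

lemma typing_type_correct:
  "typing P \<Gamma> M A \<Longrightarrow> (\<exists>s \<in> sorts P. A = Const s) \<or> is_type \<Gamma> A"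
proof (induction rule: typing.induct)
  case (ax c s)
  then show ?case by (simp add: axioms_in_sorts)
next
  case (start \<Gamma> A s)
  then have "is_type \<Gamma> A" by (auto simp: is_type_def)
  then show ?case by (blast intro: is_type_weaken)
next
  case (weakening \<Gamma> M B A s)
  then have "is_type \<Gamma> A" by (auto simp: is_type_def)
  with weakening show ?case by (auto intro: is_type_weaken)
next
  case (application \<Gamma> M A B N)
  then show ?case using is_type_subst by blast
next
  case (product A \<Gamma> B s2 s1 s3)
  then show ?case using rules_in_sorts by blast
qed (auto simp: is_type_def)

text \<open>Here \<open>C\<close> is always typed, even when it is a sort: correctness of types
  applies to \<open>Pi A B\<close>, which is no sort, and passes to the instance of
  \<open>B\<close>.\<close>

lemma typing_AppD:
  "typing P \<Gamma> (App M N) C \<Longrightarrow> \<exists>A B. typing P \<Gamma> M (Pi A B) \<and> typing P \<Gamma> N A \<and>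
    subst B N 0 =\<^sub>\<beta> C \<and> is_type \<Gamma> C"
proof (induction \<Gamma> "App M N" C arbitrary: M N rule: typing.induct)
  case (weakening \<Gamma> X C D s)
  then obtain M0 N0 where X: "X = App M0 N0" and MN: "M = lift 0 M0" "N = lift 0 N0"
    by (cases X) (auto split: if_splits)
  have D: "is_type \<Gamma> D" using weakening by (auto simp: is_type_def)
  from weakening(2)[OF X] obtain A B where *:
    "typing P \<Gamma> M0 (Pi A B)" "typing P \<Gamma> N0 A" "subst B N0 0 =\<^sub>\<beta> C" "is_type \<Gamma> C" by blast
  have "typing P (D # \<Gamma>) M (Pi (lift 0 A) (psubst (ups (\<lambda>i. Var (Suc i))) B))"
    using typing.weakening[OF *(1) weakening(3,5)]
    by (simp only: MN lift_0_eq_psubst psubst.simps)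
  moreover have "typing P (D # \<Gamma>) N (lift 0 A)"
    using typing.weakening[OF *(2) weakening(3,5)] by (simp add: MN)
  moreover have "subst (psubst (ups (\<lambda>i. Var (Suc i))) B) N 0 =\<^sub>\<beta> lift 0 C"
    using beta_eq_psubst[OF *(3)] by (simp add: MN lift_0_eq_psubst psubst_subst)
  ultimately show ?case using is_type_weaken[OF *(4) D] by blast
next
  case (application \<Gamma> M A B N)
  then have "is_type \<Gamma> (Pi A B)" using typing_type_correct by blast
  with application have "is_type \<Gamma> (subst B N 0)" by (blast intro: is_type_subst)
  with application.hyps(1,3) show ?case
    by (intro exI[of _ A] exI[of _ B]) simp
next
  case (conversion \<Gamma> C C' s)
  then show ?case by (meson equivclp_trans is_type_def)
qed

section \<open>Subject reduction\<close>

lemma typing_Pi_domain: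
  assumes "typing P \<Gamma> (Pi A B) C" "A =\<^sub>\<beta> A'" "\<And>s. typing P \<Gamma> A (Const s) \<Longrightarrow> typing P \<Gamma> A' (Const s)"
  shows "typing P \<Gamma> (Pi A' B) C"
proof -
  obtain s1 s2 s3 where *: "(s1, s2, s3) \<in> rules P" "typing P \<Gamma> A (Const s1)"
    "typing P (A # \<Gamma>) B (Const s2)" "converts \<Gamma> (Const s3) C"
    using typing_PiD[OF assms(1)] by blast
  have A': "typing P \<Gamma> A' (Const s1)" using assms(3) * by blast
  then have "is_type \<Gamma> A'" using *(1) rules_in_sorts by (auto simp: is_type_def)
  with *(3) have "typing P (A' # \<Gamma>) B (Const s2)"
    using assms(2) by (rule typing_context_conversion)
  from product[OF this A' *(1)] *(4) show ?thesis by (rule typing_converts)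
qed

text \<open>Each case inverts the derivation of the source and rebuilds one for the target. A step
  in a domain changes the context and a step in an argument changes the type; conversion repairs
  both.\<close>

theorem subject_reduction: "M \<rightarrow>\<^sub>\<beta> M' \<Longrightarrow> typing P \<Gamma> M C \<Longrightarrow> typing P \<Gamma> M' C"
proof (induction arbitrary: \<Gamma> C rule: beta.induct)
  case (beta_redex A M N)
  obtain A1 B1 where 1: "typing P \<Gamma> (Lam A M) (Pi A1 B1)" "typing P \<Gamma> N A1"
    "subst B1 N 0 =\<^sub>\<beta> C" "is_type \<Gamma> C" using typing_AppD[OF beta_redex] by blast
  obtain B where 2: "typing P (A # \<Gamma>) M B" "is_type \<Gamma> (Pi A B)" "Pi A B =\<^sub>\<beta> Pi A1 B1"
    using typing_LamD[OF 1(1)] unfolding converts_def by blast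
  \<comment> \<open>Injectivity of products matches the domain written in the abstraction with the
    domain at which the argument was typed.\<close>
  then have eq: "A1 =\<^sub>\<beta> A" "B =\<^sub>\<beta> B1"
    using Pi_beta_eq_PiD[OF 2(3)] by (auto intro: equivclp_sym)
  have "valid (A # \<Gamma>)" using 2(1) by (rule typing_valid)
  then have "typing P \<Gamma> N A" using typing_conversion[OF 1(2) _ eq(1)] by simp
  then have "typing P \<Gamma> (subst M N 0) (subst B N 0)" using 2(1) by (rule typing_subst[rotated])
  moreover have "subst B N 0 =\<^sub>\<beta> C" using beta_eq_subst_left[OF eq(2)] 1(3) by (rule equivclp_trans)
  ultimately show ?case using 1(4) by (blast intro: typing_conversion)
next
  case (beta_Pi1 A A' B)
  from beta_Pi1.prems show ?case
    by (rule typing_Pi_domain) (use beta_Pi1 in blast)+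
next
  case (beta_Pi2 B B' A)
  obtain s1 s2 s3 where *: "(s1, s2, s3) \<in> rules P" "typing P \<Gamma> A (Const s1)"
    "typing P (A # \<Gamma>) B (Const s2)" "converts \<Gamma> (Const s3) C"
    using typing_PiD[OF beta_Pi2.prems] by blast
  from product[OF beta_Pi2.IH[OF *(3)] *(2,1)] *(4) show ?case by (rule typing_converts)
next
  case (beta_Lam1 A A' M)
  obtain B s where *: "typing P (A # \<Gamma>) M B" "typing P \<Gamma> (Pi A B) (Const s)" "s \<in> sorts P"
    "converts \<Gamma> (Pi A B) C"
    using typing_LamD[OF beta_Lam1.prems] by (auto simp: is_type_def)
  have eq: "A =\<^sub>\<beta> A'" using beta_Lam1 by blast
  have Pi': "typing P \<Gamma> (Pi A' B) (Const s)" using typing_Pi_domain[OF *(2) eq] beta_Lam1.IH by blast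
  then have "is_type \<Gamma> A'" using typing_PiD[OF Pi'] rules_in_sorts by (auto simp: is_type_def)
  with *(1) have "typing P (A' # \<Gamma>) M B" using eq by (rule typing_context_conversion)
  then have "typing P \<Gamma> (Lam A' M) (Pi A' B)" using Pi' *(3) by (rule abstraction)
  \<comment> \<open>Back to the old product type, which is still typed by \<open>s\<close>.\<close>
  then have "typing P \<Gamma> (Lam A' M) (Pi A B)"
    using *(2,3) by (rule conversion) (intro beta_eq_Pi equivclp_sym[OF eq] equivclp_refl)
  then show ?case using *(4) by (rule typing_converts)
next
  case (beta_Lam2 M M' A)
  obtain B s where *: "typing P (A # \<Gamma>) M B" "typing P \<Gamma> (Pi A B) (Const s)" "s \<in> sorts P"
    "converts \<Gamma> (Pi A B) C"
    using typing_LamD[OF beta_Lam2.prems] by (auto simp: is_type_def)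
  from abstraction[OF beta_Lam2.IH[OF *(1)] *(2,3)] *(4) show ?case by (rule typing_converts)
next
  case (beta_App1 M M' N)
  obtain A B where *: "typing P \<Gamma> M (Pi A B)" "typing P \<Gamma> N A"
    "subst B N 0 =\<^sub>\<beta> C" "is_type \<Gamma> C" using typing_AppD[OF beta_App1.prems] by blast
  from application[OF beta_App1.IH[OF *(1)] *(2)] *(4,3) show ?case by (rule typing_conversion)
next
  case (beta_App2 N N' M)
  obtain A B where *: "typing P \<Gamma> M (Pi A B)" "typing P \<Gamma> N A"
    "subst B N 0 =\<^sub>\<beta> C" "is_type \<Gamma> C" using typing_AppD[OF beta_App2.prems] by blast
  have "subst B N' 0 =\<^sub>\<beta> C"
    using equivclp_trans[OF equivclp_sym[OF beta_eq_subst_right[OF beta_App2.hyps]] *(3)] .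
  from application[OF *(1) beta_App2.IH[OF *(2)]] *(4) this show ?case by (rule typing_conversion)
qed

lemma subject_reductions: "beta\<^sup>*\<^sup>* M M' \<Longrightarrow> typing P \<Gamma> M C \<Longrightarrow> typing P \<Gamma> M' C"
  by (induction rule: rtranclp_induct) (auto intro: subject_reduction)

section \<open>Shape of terms that inhabit a sort\<close>

lemma typing_sort_not_Lam:
  assumes "typing P \<Gamma> M C" "C =\<^sub>\<beta> Const s"
  shows "M \<noteq> Lam A N"
proof
  assume "M = Lam A N"
  then obtain B where "Pi A B =\<^sub>\<beta> C"
    using typing_LamD[of \<Gamma> A N C] assms(1) unfolding converts_def by blast
  from equivclp_trans[OF this assms(2)] show False by simp
qed

lemma typing_sort_not_App:
  assumes "typing P \<Gamma> M C" "C =\<^sub>\<beta> Const s"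
    and no_rule: "\<And>t s1 s3. (s, t) \<in> axioms P \<Longrightarrow> (s1, t, s3) \<notin> rules P"
  shows "M \<noteq> App F N"
proof
  assume "M = App F N"
  with assms(1) obtain A B where *: "typing P \<Gamma> F (Pi A B)" "typing P \<Gamma> N A" "subst B N 0 =\<^sub>\<beta> C"
    using typing_AppD by blast
  \<comment> \<open>A product is not a sort, so it has a type itself; this exposes the rule that
    formed it, with second component \<open>s2\<close>.\<close>
  obtain s0 where "typing P \<Gamma> (Pi A B) (Const s0)"
    using typing_type_correct[OF *(1)] by (auto simp: is_type_def)
  then obtain s1 s2 s3 where r: "(s1, s2, s3) \<in> rules P" "typing P (A # \<Gamma>) B (Const s2)"
    using typing_PiD by blast
  have "typing P \<Gamma> (subst B N 0) (Const s2)" using typing_subst[OF r(2) *(2)] by simp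
  moreover have "beta\<^sup>*\<^sup>* (subst B N 0) (Const s)"
    using equivclp_trans[OF *(3) assms(2)] by (rule beta_eq_Const)
  \<comment> \<open>The instance of \<open>B\<close> inherits the type \<open>Const s2\<close> and
    reduces to \<open>Const s\<close>, so \<open>s2\<close> types \<open>s\<close>: this is what
    \<open>no_rule\<close> forbids.\<close>
  ultimately have "typing P \<Gamma> (Const s) (Const s2)" by (blast intro: subject_reductions)
  from typing_ConstD[OF this] have "(s, s2) \<in> axioms P" by (auto simp: converts_def)
  with r(1) no_rule show False by blast
qed

end


section \<open>Towers of products\<close>

text \<open>\<open>K\<close> and \<open>E\<close> go under the binders without lifting, as they are
  meant to be closed; \<open>lift_K\<close> and \<open>lift_E\<close> below ensure this.\<close>

primrec tower :: "'c pterm \<Rightarrow> 'c pterm \<Rightarrow> nat \<Rightarrow> 'c pterm" where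
  "tower K E 0 = E"
| "tower K E (Suc n) = Pi K (tower K E n)"

text \<open>
  The set of sorts is more than one sort because in the AUTOMATH systems the height 0 tower has
  type \<open>\<box>\<close> and the higher ones have type \<open>\<triangle>\<close>.
\<close>

locale product_tower = pure_type_system P for P :: "'c pts" +
  fixes T :: "'c set" and k :: 'c and K E :: "'c pterm"
  assumes no_rule: "t \<in> T \<Longrightarrow> (t, t') \<in> axioms P \<Longrightarrow> (s1, t', s3) \<notin> rules P"
    and closed_T: "(s1, s2, s3) \<in> rules P \<Longrightarrow> s2 \<in> T \<Longrightarrow> s3 \<in> T"
    and extend_T: "t \<in> T \<Longrightarrow> \<exists>t' \<in> T. (k, t, t') \<in> rules P"
    and k_sort: "k \<in> sorts P"
    and lift_K: "lift 0 K = K" and typing_K: "typing P [] K (Const k)"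
    and lift_E: "lift 0 E = E" and typing_E: "\<exists>t \<in> T. typing P [] E (Const t)"
    and typing_E_sort: "typing P \<Gamma> E C \<Longrightarrow> \<exists>t \<in> T. Const t =\<^sub>\<beta> C"
begin

lemma typing_replicate:
  "lift 0 M = M \<Longrightarrow> typing P [] M (Const s) \<Longrightarrow> typing P (replicate n K) M (Const s)"
proof -
  have K: "typing P (replicate n K) K (Const k)" for n
  proof (induction n)
    case (Suc n)
    show ?case using weakening[OF Suc Suc k_sort] by (simp add: lift_K)
  qed (simp add: typing_K)
  assume M: "lift 0 M = M" "typing P [] M (Const s)"
  show ?thesis
  proof (induction n)
    case (Suc n)
    show ?case using weakening[OF Suc K k_sort] by (simp add: M(1))
  qed (simp add: M(2))
qed

text \<open>Each product of the tower moves one more \<open>K\<close> into the context, hence the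
  arbitrary \<open>m\<close>.\<close>

lemma typing_tower: "\<exists>t \<in> T. typing P (replicate m K) (tower K E n) (Const t)"
proof (induction n arbitrary: m)
  case 0
  then show ?case using typing_E typing_replicate[OF lift_E] by auto
next
  case (Suc n)
  obtain t where t: "t \<in> T" "typing P (K # replicate m K) (tower K E n) (Const t)"
    using Suc[of "Suc m"] by auto
  obtain t' where "t' \<in> T" "(k, t, t') \<in> rules P" using extend_T[OF t(1)] by blast
  with product[OF t(2) typing_replicate[OF lift_K typing_K]] show ?case by auto
qed

text \<open>The core \<open>E\<close> forces a sort in \<open>T\<close>, and \<open>closed_T\<close>
  propagates this outwards through every product.\<close>

lemma typing_tower_sort: "typing P \<Gamma> (tower K E n) C \<Longrightarrow> \<exists>t \<in> T. Const t =\<^sub>\<beta> C"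
proof (induction n arbitrary: \<Gamma> C)
  case 0
  then show ?case using typing_E_sort by simp
next
  case (Suc n)
  obtain s1 s2 s3 where *: "(s1, s2, s3) \<in> rules P"
    "typing P (K # \<Gamma>) (tower K E n) (Const s2)" "Const s3 =\<^sub>\<beta> C"
    using typing_PiD[OF Suc.prems[unfolded tower.simps]] unfolding converts_def by blast
  from Suc.IH[OF *(2)] have "s2 \<in> T" by auto
  with *(1) closed_T have "s3 \<in> T" by blast
  with *(3) show ?case by blast
qed

lemma typing_reduces_tower_size:
  "typing P \<Gamma> M C \<Longrightarrow> beta\<^sup>*\<^sup>* M (tower K E n) \<Longrightarrow> n \<le> size M"
proof (induction n arbitrary: \<Gamma> M C)
  case (Suc n)
  obtain t where t: "t \<in> T" "C =\<^sub>\<beta> Const t"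
    \<comment> \<open>By subject reduction \<open>C\<close> is also a type of the tower, hence
      convertible to a sort in \<open>T\<close>. This rules out abstractions and applications for
      \<open>M\<close>, while variables and constants do not reduce to products.\<close>
    using typing_tower_sort[OF subject_reductions[OF Suc.prems(2,1)]] equivclp_sym by metis
  have "\<exists>A B. M = Pi A B"
  proof (cases M)
    case (Lam A N)
    then show ?thesis using typing_sort_not_Lam[OF Suc.prems(1) t(2)] by blast
  next
    case (App F N)
    then show ?thesis using typing_sort_not_App[OF Suc.prems(1) t(2) no_rule[OF t(1)]] by blast
  qed (use Suc.prems(2) in \<open>auto dest: betas_Const betas_Var\<close>)
  then obtain A B where M: "M = Pi A B" by blast
  then have "beta\<^sup>*\<^sup>* B (tower K E n)" using Suc.prems(2) by (auto dest: betas_Pi_left)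
  moreover obtain s2 where "typing P (A # \<Gamma>) B (Const s2)"
    using typing_PiD Suc.prems(1) M by blast
  ultimately have "n \<le> size B" using Suc.IH by blast
  then show ?case by (simp add: M)
qed simp

text \<open>Apart from reducts, only (application) builds new subjects, and it cannot yield an
  inhabitant of such a sort. The type is fixed only up to conversion so that the induction passes
  through (conversion) and (type reduction). That \<open>M0\<close> is derivable is recorded because
  the size bound needs a typed term.\<close>

lemma htyping_sort_reduct:
  assumes eqv: "equivalent H P"
  shows "htyping H M C \<Longrightarrow> C =\<^sub>\<beta> Const t \<Longrightarrow> t \<in> T \<Longrightarrow>
    \<exists>M0 A0. beta\<^sup>*\<^sup>* M0 M \<and> htyping H M0 A0 \<and>
      (size M0 = 1 \<or> (\<exists>(N, A) \<in> schemes H. size M0 = size N))"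
proof (induction rule: htyping.induct)
  case (h_ax c s)
  have "size (Const c) = 1" by simp
  with htyping.h_ax[OF h_ax.hyps] show ?case by blast
next
  case (h_scheme N A \<sigma>)
  \<comment> \<open>Instantiation swaps constants for constants, so a scheme bounds all of its
    instances at once.\<close>
  have "size (inst \<sigma> N) = size N" by (induction N) simp_all
  with h_scheme.hyps(1) htyping.h_scheme[OF h_scheme.hyps] show ?case by blast
next
  case (h_application F A B N)
  have "typing P [] (App F N) (subst B N 0)"
    using eqv htyping.h_application[OF h_application.hyps] by (simp add: equivalent_def)
  from typing_sort_not_App[OF this h_application.prems(1) no_rule[OF h_application.prems(2)]]
  show ?case by blast
next
  case (h_conversion M A B s)
  then show ?case by (blast intro: equivclp_trans)
next
  case (h_type_reduction M A B)
  then show ?case by (blast intro: equivclp_trans)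
next
  case (h_subject_reduction M A N)
  then show ?case by (blast intro: rtranclp.rtrancl_into_rtrancl)
qed

theorem no_equivalent_hpts: "\<not> has_equivalent_hpts P"
proof
  assume "has_equivalent_hpts P"
  then obtain H where H: "finite (schemes H)" "equivalent H P"
    by (auto simp: has_equivalent_hpts_def wf_hpts_def)
  \<comment> \<open>This bounds the sizes of all axiom subjects; 1 is the size of a constant and
    keeps the set nonempty. A tower of height \<open>Suc b\<close> is then out of reach.\<close>
  define b where "b = Max (insert 1 ((\<lambda>(N, A). size N) ` schemes H))"
  obtain t where t: "t \<in> T" "typing P [] (tower K E (Suc b)) (Const t)"
    using typing_tower[of 0 "Suc b"] by auto
  then have "htyping H (tower K E (Suc b)) (Const t)" using H(2) unfolding equivalent_def by blast
  from htyping_sort_reduct[OF H(2) this equivclp_refl t(1)]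
  obtain M0 A0 where M0: "beta\<^sup>*\<^sup>* M0 (tower K E (Suc b))" "htyping H M0 A0"
    "size M0 = 1 \<or> (\<exists>(N, A) \<in> schemes H. size M0 = size N)" by blast
  have "typing P [] M0 A0" using M0(2) H(2) unfolding equivalent_def by blast
  from typing_reduces_tower_size[OF this M0(1)] have "Suc b \<le> size M0" .
  moreover have "size M0 \<in> insert 1 ((\<lambda>(N, A). size N) ` schemes H)"
    using M0(3) by force
  then have "size M0 \<le> b" unfolding b_def using H(1) by (intro Max_ge) auto
  ultimately show False by simp
qed

end


section \<open>The systems\<close>

text \<open>The tower uses one constant \<open>c\<close> both as domain and as core. It serves every
  system that can form products of \<open>c\<close> over \<open>c\<close> repeatedly.\<close>

lemma no_equivalent_hpts_constant_tower:
  assumes "wf_pts P" "(c, k) \<in> axioms P" "\<And>s. (c, s) \<in> axioms P \<Longrightarrow> s \<in> T"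
    and "\<And>t t' s1 s3. t \<in> T \<Longrightarrow> (t, t') \<in> axioms P \<Longrightarrow> (s1, t', s3) \<notin> rules P"
    and "\<And>s1 s2 s3. (s1, s2, s3) \<in> rules P \<Longrightarrow> s2 \<in> T \<Longrightarrow> s3 \<in> T"
    and "\<And>t. t \<in> T \<Longrightarrow> \<exists>t' \<in> T. (k, t, t') \<in> rules P"
  shows "\<not> has_equivalent_hpts P"
proof -
  interpret pure_type_system P by unfold_locales fact
  interpret product_tower P T k "Const c" "Const c"
  proof
    show "\<exists>t \<in> T. typing P [] (Const c) (Const t)" using ax[OF assms(2)] assms(3)[OF assms(2)] by blast
    show "\<exists>t \<in> T. Const t =\<^sub>\<beta> C" if "typing P \<Gamma> (Const c) C" for \<Gamma> C
      using typing_ConstD[OF that] assms(3) unfolding converts_def by blast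
    show "typing P [] (Const c) (Const k)" using assms(2) by (rule ax)
    show "k \<in> sorts P" using assms(2) by (rule axioms_in_sorts)
  qed (fact assms | simp)+
  show ?thesis by (rule no_equivalent_hpts)
qed

text \<open>The polymorphic falsum: a closed inhabitant of \<open>c\<close> available when products
  over \<open>c\<close> may land in \<open>c\<close> again.\<close>

lemma typing_Pi_Var0:
  assumes "(c, k) \<in> axioms P" "(k, c, c) \<in> rules P" "k \<in> sorts P"
  shows "typing P [] (Pi (Const c) (Var 0)) (Const c)"
proof -
  have "typing P [Const c] (Var 0) (Const c)"
    using start[OF ax[OF assms(1)] assms(3)] by simp
  then show ?thesis using ax[OF assms(1)] assms(2) by (rule product)
qed

lemma no_equivalent_hpts_lambda_2: "\<not> has_equivalent_hpts lambda_2"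
proof -
  interpret pure_type_system lambda_2 by unfold_locales (fact wf_pts_systems)
  interpret product_tower lambda_2 "{StarC}" BoxC "Const StarC" "Pi (Const StarC) (Var 0)"
  proof
    show "typing lambda_2 [] (Const StarC) (Const BoxC)"
      by (rule ax) (simp add: lambda_2_def cube_def)
    show "\<exists>t \<in> {StarC}. typing lambda_2 [] (Pi (Const StarC) (Var 0)) (Const t)"
      using typing_Pi_Var0[of StarC BoxC lambda_2] by (simp add: lambda_2_def cube_def)
    show "\<exists>t \<in> {StarC}. Const t =\<^sub>\<beta> C" if E: "typing lambda_2 \<Gamma> (Pi (Const StarC) (Var 0)) C" for \<Gamma> C
    proof -
      obtain s1 s2 s3 where *: "(s1, s2, s3) \<in> rules lambda_2"
        "typing lambda_2 (Const StarC # \<Gamma>) (Var 0) (Const s2)" "Const s3 =\<^sub>\<beta> C"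
        using typing_PiD[OF E] by (auto simp: converts_def)
      \<comment> \<open>The body of the falsum is its bound variable, declared of type
        \<open>Const StarC\<close>.\<close>
      have "s2 = StarC" using typing_Var0D[OF *(2)] by simp
      with *(1) have "s3 = StarC" by (auto simp: lambda_2_def cube_def)
      with *(3) show ?thesis by simp
    qed
  qed (auto simp: lambda_2_def cube_def)
  show ?thesis by (rule no_equivalent_hpts)
qed

text \<open>The rule with components star, box, box makes the box a second component, which spoils
  the choice made for \<open>lambda_2\<close>. The same rule allows towers in the box: the falsum
  now serves as domain and \<open>*\<close> as core.\<close>

lemma no_equivalent_hpts_lambda_P2: "\<not> has_equivalent_hpts lambda_P2"
proof -
  interpret pure_type_system lambda_P2 by unfold_locales (fact wf_pts_systems)
  interpret product_tower lambda_P2 "{BoxC}" StarC "Pi (Const StarC) (Var 0)" "Const StarC"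
  proof
    show "typing lambda_P2 [] (Pi (Const StarC) (Var 0)) (Const StarC)"
      by (rule typing_Pi_Var0[where k = BoxC]) (simp_all add: lambda_P2_def cube_def)
    show "\<exists>t \<in> {BoxC}. typing lambda_P2 [] (Const StarC) (Const t)"
      by (auto intro: ax simp: lambda_P2_def cube_def)
    show "\<exists>t \<in> {BoxC}. Const t =\<^sub>\<beta> C" if E: "typing lambda_P2 \<Gamma> (Const StarC) C" for \<Gamma> C
    proof -
      obtain s where "(StarC, s) \<in> axioms lambda_P2" "Const s =\<^sub>\<beta> C"
        using typing_ConstD[OF E] unfolding converts_def by blast
      then show ?thesis by (simp add: lambda_P2_def cube_def)
    qed
  qed (auto simp: lambda_P2_def cube_def)
  show ?thesis by (rule no_equivalent_hpts)
qed

theorem theorem15: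
  shows "\<not> has_equivalent_hpts lambda_tau \<and>
    \<not> has_equivalent_hpts lambda_2 \<and>
    \<not> has_equivalent_hpts lambda_omega \<and>
    \<not> has_equivalent_hpts lambda_weak_omega \<and>
    \<not> has_equivalent_hpts lambda_P2 \<and>
    \<not> has_equivalent_hpts lambda_P_weak_omega \<and>
    \<not> has_equivalent_hpts lambda_C \<and>
    \<not> has_equivalent_hpts lambda_AUT68 \<and>
    \<not> has_equivalent_hpts lambda_AUTQE \<and>
    \<not> has_equivalent_hpts lambda_PAL \<and>
    \<not> has_equivalent_hpts lambda_U \<and>
    \<not> has_equivalent_hpts lambda_HOL"
proof (intro conjI)
  show "\<not> has_equivalent_hpts lambda_tau"
    by (rule no_equivalent_hpts_constant_tower[OF wf_pts_systems(1), of ZeroT StarT "{StarT}"])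
      (auto simp: lambda_tau_def)
  show "\<not> has_equivalent_hpts lambda_2" by (rule no_equivalent_hpts_lambda_2)
  show "\<not> has_equivalent_hpts lambda_omega"
    by (rule no_equivalent_hpts_constant_tower[OF wf_pts_systems(3), of StarC BoxC "{BoxC}"])
      (auto simp: lambda_omega_def cube_def)
  show "\<not> has_equivalent_hpts lambda_weak_omega"
    by (rule no_equivalent_hpts_constant_tower[OF wf_pts_systems(4), of StarC BoxC "{BoxC}"])
      (auto simp: lambda_weak_omega_def cube_def)
  show "\<not> has_equivalent_hpts lambda_P2" by (rule no_equivalent_hpts_lambda_P2)
  show "\<not> has_equivalent_hpts lambda_P_weak_omega"
    by (rule no_equivalent_hpts_constant_tower[OF wf_pts_systems(6), of StarC BoxC "{BoxC}"])
      (auto simp: lambda_P_weak_omega_def cube_def)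
  show "\<not> has_equivalent_hpts lambda_C"
    by (rule no_equivalent_hpts_constant_tower[OF wf_pts_systems(7), of StarC BoxC "{BoxC}"])
      (auto simp: lambda_C_def cube_def)
  show "\<not> has_equivalent_hpts lambda_AUT68"
    by (rule no_equivalent_hpts_constant_tower[OF wf_pts_systems(8), of Star Box "{Box, Triangle}"])
      (auto simp: lambda_AUT68_def)
  show "\<not> has_equivalent_hpts lambda_AUTQE"
    by (rule no_equivalent_hpts_constant_tower[OF wf_pts_systems(9), of Star Box "{Box, Triangle}"])
      (auto simp: lambda_AUTQE_def)
  show "\<not> has_equivalent_hpts lambda_PAL"
    by (rule no_equivalent_hpts_constant_tower[OF wf_pts_systems(10), of Star Box "{Box, Triangle}"])
      (auto simp: lambda_PAL_def)
  \<comment> \<open>In the last two systems the box does have a type, the triangle, but no rule has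
    the triangle as second component.\<close>
  show "\<not> has_equivalent_hpts lambda_U"
    by (rule no_equivalent_hpts_constant_tower[OF wf_pts_systems(11), of Star Box "{Box}"])
      (auto simp: lambda_U_def)
  show "\<not> has_equivalent_hpts lambda_HOL"
    by (rule no_equivalent_hpts_constant_tower[OF wf_pts_systems(12), of Star Box "{Box}"])
      (auto simp: lambda_HOL_def)
qed

end
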